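(* Let $n \ge 3$ and $2 \le k \le n-1$ be integers, let $c_1,\ldots,c_r \ge 1$ be integers with $d = c_1 + \cdots + c_r$, let $G = T(n,k,(c_1,\ldots,c_r))$ and $t(v_i) = t(G, v_i, v_n)$. Then \[ t(v_i) = \begin{cases} n^2 - k^2 + 2(d-1)(n-k) + (k-1)^2 - (i-1)^2, & 1 \le i \le k-1,\\ n^2 - i^2 + 2(d-1)(n-i), & k \le i \le n-1. \end{cases} \]
   Context: $T(n,k,(c_1,\ldots,c_r))$ is the tree consisting of a path (spine) $v_1 v_2 \cdots v_n$ together with $r$ vertex-disjoint pendant paths $S_1,\ldots,S_r$ attached at $v_k$: $S_i$ has $c_i$ vertices, one endpoint $u_i$ of $S_i$ is adjacent to $v_k$, the other endpoint has degree $1$, and internal vertices have degree $2$ (for $c_i=1$, $S_i$ is a single leaf adjacent to $v_k$). $t(G,v,u)$ denotes the expected number of steps until a simple random walk on $G$ started at $v$ (moving each step to a uniformly random neighbor) first reaches $u$. *)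

theory Defs
  imports "HOL-Probability.Probability" "Graph_Theory.Graph_Theory"
begin

text \<open>Finite simple undirected graphs are the digraphs satisfying \<^locale>\<open>pair_graph\<close>: each
  undirected edge is represented by its two orientations.\<close>

text \<open>The uniform neighbour; meaningful only at vertices whose neighbourhood is finite and nonempty.\<close>
definition srw_step :: "'a pair_pre_digraph \<Rightarrow> 'a \<Rightarrow> 'a pmf" where
  "srw_step G x = pmf_of_set {y. (x, y) \<in> parcs G}"

definition srw_kernel :: "'a pair_pre_digraph \<Rightarrow> 'a \<Rightarrow> nat \<Rightarrow> (nat \<Rightarrow> 'a) \<Rightarrow> 'a measure" where
  "srw_kernel G v m \<omega> = measure_pmf (if m = 0 then return_pmf v else srw_step G (\<omega> (m - 1)))"

lemma Ionescu_Tulcea_srw: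
  fixes v :: 'a
  shows "Ionescu_Tulcea (srw_kernel G v) (\<lambda>_. count_space UNIV)"
proof (rule Ionescu_Tulcea.intro)
  fix m
  show "srw_kernel G v m \<in>
    measurable (PiM {0..<m} (\<lambda>_. count_space UNIV)) (subprob_algebra (count_space UNIV))"
  proof (cases m)
    case 0
    then show ?thesis
      by (auto simp: srw_kernel_def[abs_def] space_subprob_algebra
          measure_pmf.subprob_space_axioms)
  next
    case (Suc l)
    have "(\<lambda>\<omega>. \<omega> l) \<in> measurable (PiM {0..<m} (\<lambda>_. count_space UNIV)) (count_space UNIV)"
      using Suc by (intro measurable_component_singleton) auto
    moreover have "(\<lambda>x. measure_pmf (srw_step G x)) \<in>
        measurable (count_space UNIV) (subprob_algebra (count_space UNIV))"
      by (auto simp: space_subprob_algebra measure_pmf.subprob_space_axioms)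
    ultimately show ?thesis
      using Suc by (auto simp: srw_kernel_def[abs_def] intro: measurable_compose)
  qed
next
  fix m :: nat and x :: "nat \<Rightarrow> 'a"
  show "prob_space (srw_kernel G v m x)"
    by (simp add: srw_kernel_def measure_pmf.prob_space_axioms)
qed

text \<open>The law, on the space of trajectories \<open>nat \<Rightarrow> 'a\<close>, of the walk started at \<open>v\<close>.\<close>
definition srw :: "'a pair_pre_digraph \<Rightarrow> 'a \<Rightarrow> (nat \<Rightarrow> 'a) measure" where
  "srw G v = projective_family.lim UNIV
     (Ionescu_Tulcea.CI (srw_kernel G v) (\<lambda>_. count_space UNIV)) (\<lambda>_. count_space UNIV)"

text \<open>The infimum is \<open>\<infinity>\<close> if \<open>u\<close> is never visited.\<close>
definition hitting_time :: "'a \<Rightarrow> (nat \<Rightarrow> 'a) \<Rightarrow> enat" where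
  "hitting_time u \<omega> = (INF m \<in> {m. \<omega> m = u}. enat m)"

definition expected_hitting_time :: "'a pair_pre_digraph \<Rightarrow> 'a \<Rightarrow> 'a \<Rightarrow> ennreal" where
  "expected_hitting_time G v u = (\<integral>\<^sup>+ \<omega>. ennreal_of_enat (hitting_time u \<omega>) \<partial>srw G v)"

lemma sets_srw [measurable_cong]: "sets (srw G v) = sets (PiM UNIV (\<lambda>_. count_space UNIV))"
  and space_srw [simp]: "space (srw G v) = UNIV"
proof -
  interpret Ionescu_Tulcea "srw_kernel G v" "\<lambda>_. count_space UNIV"
    by (rule Ionescu_Tulcea_srw)
  show "sets (srw G v) = sets (PiM UNIV (\<lambda>_. count_space UNIV))"
    by (simp add: srw_def)
  from sets_eq_imp_space_eq[OF this] show "space (srw G v) = UNIV"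
    by (simp add: space_PiM)
qed

lemma measurable_srw_component [measurable]:
  "(\<lambda>\<omega>. \<omega> m) \<in> measurable (srw G v) (count_space UNIV)"
  by (simp add: measurable_cong_sets[OF sets_srw refl] measurable_component_singleton)

lemma prob_space_srw: "prob_space (srw G v)"
proof -
  interpret Ionescu_Tulcea "srw_kernel G v" "\<lambda>_. count_space UNIV"
    by (rule Ionescu_Tulcea_srw)
  show ?thesis
    unfolding srw_def
    by (rule prob_space_distrD[of "\<lambda>\<omega>. restrict \<omega> {}" _ "PiM {} (\<lambda>_. count_space UNIV)"])
       (simp_all add: distr_lim PF.prob_space_P measurable_cong_sets[OF PF.sets_lim refl] measurable_restrict)
qed

lemma measurable_hitting_time [measurable]:
  "(\<lambda>\<omega>. ennreal_of_enat (hitting_time u \<omega>)) \<in> borel_measurable (srw G v)"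
proof -
  have hitting_inf: "ennreal_of_enat (hitting_time u \<omega>) = (INF m. if \<omega> m = u then of_nat m else \<top>)" for \<omega>
  proof (cases "\<exists>m. \<omega> m = u")
    case False
    then show ?thesis
      by (simp add: hitting_time_def top_enat_def)
  next
    case True
    define l where "l = (LEAST m. \<omega> m = u)"
    have l: "\<omega> l = u" "\<And>m. \<omega> m = u \<Longrightarrow> l \<le> m"
      using True by (auto simp: l_def intro: LeastI_ex Least_le)
    have "hitting_time u \<omega> = enat l"
      unfolding hitting_time_def by (rule antisym) (auto intro!: INF_lower INF_greatest l)
    moreover have "(INF m. if \<omega> m = u then of_nat m else \<top>) = (of_nat l :: ennreal)"
    proof (rule antisym)
      show "(INF m. if \<omega> m = u then of_nat m else \<top>) \<le> (of_nat l :: ennreal)"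
        by (rule INF_lower2[of l]) (simp_all add: l(1))
      show "(of_nat l :: ennreal) \<le> (INF m. if \<omega> m = u then of_nat m else \<top>)"
        by (rule INF_greatest) (simp add: l(2))
    qed
    ultimately show ?thesis
      by simp
  qed
  then show ?thesis
    unfolding hitting_inf by measurable
qed

lemma emeasure_srw_cylinder:
  "emeasure (srw G v) {\<omega>. \<forall>j\<le>m. \<omega> j = x j} =
     (if x 0 = v then (\<Prod>j<m. ennreal (pmf (srw_step G (x j)) (x (Suc j)))) else 0)"
proof -
  interpret Ionescu_Tulcea "srw_kernel G v" "\<lambda>_. count_space UNIV"
    by (rule Ionescu_Tulcea_srw)
  let ?M = "\<lambda>l. PiM {0..<l} (\<lambda>_::nat. count_space (UNIV :: 'a set))"
  define X where "X l = PiE {0..<l} (\<lambda>j. {x j})" for l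
  have X [measurable]: "X l \<in> sets (?M l)" for l
    unfolding X_def by (intro sets_PiM_I_finite) auto
  have eP: "emeasure (eP l \<omega>) (X (Suc l)) = emeasure (srw_kernel G v l x) {x l} * indicator (X l) \<omega>"
    if \<omega>: "\<omega> \<in> space (?M l)" for l \<omega>
  proof -
    have ext: "\<omega> \<in> extensional {0..<l}"
      using \<omega> by (simp add: space_PiM PiE_iff)
    have "(\<lambda>y. fun_upd \<omega> l y) -` X (Suc l) \<inter> UNIV = (if \<omega> \<in> X l then {x l} else {})"
      using ext by (auto simp: X_def PiE_iff extensional_def less_Suc_eq split: if_splits)
    moreover have "srw_kernel G v l \<omega> = srw_kernel G v l x" if "\<omega> \<in> X l"
      using that by (auto simp: srw_kernel_def X_def PiE_iff)
    ultimately show ?thesis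
      by (simp add: emeasure_eP[OF \<omega> X])
  qed
  have C: "emeasure (C 0 l (\<lambda>_. undefined)) (X l) =
      (\<Prod>j<l. emeasure (srw_kernel G v j x) {x j})" for l
  proof (induction l)
    case 0
    then show ?case
      by (simp add: X_def PiM_empty)
  next
    case (Suc l)
    have und: "(\<lambda>_. undefined) \<in> space (?M 0)"
      by (simp add: space_PiM)
    have sp: "space (C 0 l (\<lambda>_. undefined)) = space (?M l)"
      and st: "sets (C 0 l (\<lambda>_. undefined)) = sets (?M l)"
      using space_C[OF und, of l] sets_C[OF und, of l] by simp_all
    have "emeasure (C 0 (Suc l) (\<lambda>_. undefined)) (X (Suc l)) =
        (\<integral>\<^sup>+\<omega>. emeasure (eP l \<omega>) (X (Suc l)) \<partial>C 0 l (\<lambda>_. undefined))"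
      using prob_space.not_empty[OF prob_space_C[OF und, of l]]
      by (simp, subst emeasure_bind[where N = "?M (Suc l)"])
         (auto simp: measurable_cong_sets[OF st refl])
    also have "\<dots> = (\<integral>\<^sup>+\<omega>. emeasure (srw_kernel G v l x) {x l} * indicator (X l) \<omega>
        \<partial>C 0 l (\<lambda>_. undefined))"
      by (intro nn_integral_cong eP) (simp add: sp)
    also have "\<dots> = emeasure (srw_kernel G v l x) {x l} * emeasure (C 0 l (\<lambda>_. undefined)) (X l)"
      by (intro nn_integral_cmult_indicator) (simp add: st)
    finally show ?case
      by (simp add: Suc.IH mult.commute)
  qed
  have "{\<omega>. \<forall>j\<le>m. \<omega> j = x j} = PF.emb UNIV {0..<Suc m} (X (Suc m))"
    by (auto simp: X_def prod_emb_def space_PiM PiE_iff less_Suc_eq_le)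
  then have "emeasure (srw G v) {\<omega>. \<forall>j\<le>m. \<omega> j = x j} =
      emeasure (C 0 (Suc m) (\<lambda>_. undefined)) (X (Suc m))"
    using X[of "Suc m"] sets.sets_into_space[OF X[of "Suc m"]]
    by (simp add: srw_def lim emeasure_CI[where n = "Suc m"] prod_emb_id
        space_PiM del: C.simps)
  also have "\<dots> = (\<Prod>j<Suc m. emeasure (srw_kernel G v j x) {x j})"
    by (rule C)
  also have "\<dots> = (if x 0 = v then (\<Prod>j<m. ennreal (pmf (srw_step G (x j)) (x (Suc j)))) else 0)"
    unfolding prod.lessThan_Suc_shift
    by (simp add: srw_kernel_def emeasure_pmf_single)
  finally show ?thesis .
qed

text \<open>\<open>Spine i\<close> is the \<open>i\<close>-th spine vertex, \<open>1 \<le> i \<le> n\<close>; \<open>Pendant i j\<close> is the \<open>j\<close>-th vertex of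
  the \<open>i\<close>-th pendant path counted from the spine, \<open>1 \<le> j \<le> cs ! i\<close>, where the pendant paths are
  numbered from \<open>0\<close>.\<close>
datatype vertex = Spine nat | Pendant nat nat

definition spine_tree :: "nat \<Rightarrow> nat \<Rightarrow> nat list \<Rightarrow> vertex pair_pre_digraph" where
  "spine_tree n k cs =
    (let E = {(Spine i, Spine (Suc i)) | i. 1 \<le> i \<and> i < n}
           \<union> {(Spine k, Pendant i 1) | i. i < length cs}
           \<union> {(Pendant i j, Pendant i (Suc j)) | i j. i < length cs \<and> 1 \<le> j \<and> j < cs ! i}
     in \<lparr> pverts = {Spine i | i. 1 \<le> i \<and> i \<le> n}
                 \<union> {Pendant i j | i j. i < length cs \<and> 1 \<le> j \<and> j \<le> cs ! i},
          parcs = E \<union> E\<inverse> \<rparr>)"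

lemma pair_graph_spine_tree:
  assumes "1 \<le> k" "k \<le> n" "\<forall>c\<in>set cs. 1 \<le> c"
  shows "pair_graph (spine_tree n k cs)"
proof -
  let ?T = "spine_tree n k cs"
  have cs: "Suc 0 \<le> cs ! i" if "i < length cs" for i
    using assms(3) nth_mem[OF that] by fastforce
  have wf: "fst e \<in> pverts ?T \<and> snd e \<in> pverts ?T \<and> fst e \<noteq> snd e" if "e \<in> parcs ?T" for e
    using that assms cs by (auto simp: spine_tree_def Let_def)
  have "pverts ?T = Spine ` {1..n} \<union> (\<Union>i<length cs. Pendant i ` {1..cs ! i})"
    by (auto simp: spine_tree_def Let_def)
  then have fin: "finite (pverts ?T)"
    by simp
  have "parcs ?T \<subseteq> pverts ?T \<times> pverts ?T"
    using wf by (auto simp: mem_Times_iff)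
  then have fin': "finite (parcs ?T)"
    by (rule finite_subset) (simp add: fin)
  have "symmetric ?T"
    by (auto simp: symmetric_def sym_def spine_tree_def Let_def)
  with wf fin fin' show ?thesis
    by unfold_locales auto
qed

end

theory Submission
  imports Defs
begin

text \<open>Expected hitting times of \<open>u\<close> solve the Poisson equation:
  \<open>h u = 0\<close>, and elsewhere \<open>h x\<close> is 1 plus the mean of \<open>h\<close>
  over the neighbours of \<open>x\<close>. Conversely, a bounded nonnegative solution must be the
  expected hitting time: by the Markov property (\<open>markov_srw\<close>), \<open>h\<close> at the
  current vertex plus the elapsed time, stopped at \<open>u\<close>, has constant expectation, and
  letting time tend to infinity yields \<open>expected_hitting_time_eqI\<close>. Recurrence need not
  be known beforehand.

  Multiplied by the degree, the equation says that the differences \<open>h x - h y\<close> over the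
  neighbours \<open>y\<close> of \<open>x\<close> sum to the degree of \<open>x\<close>
  (\<open>expected_hitting_time_eq_potential\<close>). On a tree this determines \<open>h\<close>
  edge by edge: summing over the m vertices cut off from \<open>u\<close> by an edge, everything
  cancels except the difference across that edge, which is therefore 2m - 1. Behind the edge from
  \<open>Spine i\<close> to \<open>Spine (Suc i)\<close> lie \<open>i\<close> vertices if
  \<open>i < k\<close>, and \<open>i + d\<close> otherwise. Adding these differences back from
  \<open>Spine n\<close> gives the stated formula, \<open>spine_time\<close>; extended to the
  pendant paths it is \<open>tree_time\<close>, for which the degree identity is checked at each
  kind of vertex.\<close>

section \<open>The Markov property of the trajectory measure\<close>

text \<open>The stage with one more coordinate is a bind of the previous stage with a kernel that
  looks only at the last coordinate. Applying \<open>F\<close> to a restricted trajectory expresses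
  dependence on the times up to \<open>m\<close> alone.\<close>

lemma markov_srw:
  fixes F :: "(nat \<Rightarrow> 'a) \<Rightarrow> ennreal" and g :: "'a \<Rightarrow> ennreal"
  assumes F: "F \<in> borel_measurable (PiM {0..<Suc m} (\<lambda>_. count_space UNIV))"
  shows "(\<integral>\<^sup>+\<omega>. F (restrict \<omega> {0..<Suc m}) * g (\<omega> (Suc m)) \<partial>srw G v) =
    (\<integral>\<^sup>+\<omega>. F (restrict \<omega> {0..<Suc m}) * (\<integral>\<^sup>+y. g y \<partial>srw_step G (\<omega> m)) \<partial>srw G v)"
proof -
  interpret Ionescu_Tulcea "srw_kernel G v" "\<lambda>_. count_space UNIV"
    by (rule Ionescu_Tulcea_srw)
  let ?M = "\<lambda>l. PiM {0..<l} (\<lambda>_::nat. count_space (UNIV :: 'a set))"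
  let ?C = "\<lambda>l. C 0 l (\<lambda>_. undefined)"
  have und: "(\<lambda>_. undefined) \<in> space (?M 0)"
    by (simp add: space_PiM)
  have sp: "space (?C l) = space (?M l)" and st: "sets (?C l) = sets (?M l)" for l
    using space_C[OF und, of l] sets_C[OF und, of l] by simp_all
  have prefix: "(\<integral>\<^sup>+\<omega>. f (restrict \<omega> {0..<l}) \<partial>srw G v) = (\<integral>\<^sup>+\<omega>. f \<omega> \<partial>?C l)"
    if f [measurable]: "f \<in> borel_measurable (?M l)" for f l
  proof -
    \<comment> \<open>\<open>CI J\<close> is the image of stage \<open>up_to J\<close> under
      restriction to \<open>J\<close>; on an initial segment that restriction changes
      nothing.\<close>
    have up: "up_to {0..<l} = l"
    proof (rule antisym)
      show "up_to {0..<l} \<le> l"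
        by (simp add: up_to_iff)
      show "l \<le> up_to {0..<l}"
        by (rule leI) (use up_to_less[of "{0..<l}" "up_to {0..<l}"] in auto)
    qed
    have r: "(\<lambda>\<omega>. restrict \<omega> {0..<l}) \<in> measurable (srw G v) (?M l)"
      by (simp add: measurable_cong_sets[OF sets_srw refl] measurable_restrict)
    have r': "(\<lambda>\<omega>. restrict \<omega> {0..<l}) \<in> measurable (?C l) (?M l)"
      by (simp add: measurable_cong_sets[OF st refl] measurable_restrict)
    have "(\<integral>\<^sup>+\<omega>. f (restrict \<omega> {0..<l}) \<partial>srw G v) =
        (\<integral>\<^sup>+\<omega>. f \<omega> \<partial>distr (srw G v) (?M l) (\<lambda>\<omega>. restrict \<omega> {0..<l}))"
      by (subst nn_integral_distr[OF r]) (use f in simp_all)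
    also have "distr (srw G v) (?M l) (\<lambda>\<omega>. restrict \<omega> {0..<l}) = CI {0..<l}"
      by (simp add: srw_def distr_lim)
    also have "(\<integral>\<^sup>+\<omega>. f \<omega> \<partial>CI {0..<l}) = (\<integral>\<^sup>+\<omega>. f (restrict \<omega> {0..<l}) \<partial>?C l)"
      unfolding CI_def up by (subst nn_integral_distr[OF r']) (use f in simp_all)
    also have "\<dots> = (\<integral>\<^sup>+\<omega>. f \<omega> \<partial>?C l)"
      by (intro nn_integral_cong arg_cong[where f = f])
        (auto simp: sp space_PiM PiE_iff extensional_restrict)
    finally show ?thesis .
  qed
  have comp: "(\<lambda>\<omega>. f (\<omega> j)) \<in> borel_measurable (?M l)" if "j < l" for j l and f :: "'a \<Rightarrow> ennreal"
    by (rule measurable_compose[OF measurable_component_singleton]) (use that in auto)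
  define K where "K x = (\<integral>\<^sup>+y. g y \<partial>srw_step G x)" for x
  define L where "L \<omega> = F (restrict \<omega> {0..<Suc m}) * g (\<omega> (Suc m))" for \<omega>
  have L: "L \<in> borel_measurable (?M (Suc (Suc m)))"
    unfolding L_def
  proof (rule borel_measurable_times_ennreal)
    show "(\<lambda>\<omega>. F (restrict \<omega> {0..<Suc m})) \<in> borel_measurable (?M (Suc (Suc m)))"
      by (rule measurable_compose[OF measurable_restrict_subset F]) simp
  qed (rule comp, simp)
  have FK: "(\<lambda>\<omega>. F \<omega> * K (\<omega> m)) \<in> borel_measurable (?M (Suc m))"
    by (rule borel_measurable_times_ennreal[OF F comp]) simp
  have "(\<integral>\<^sup>+\<omega>. L \<omega> \<partial>srw G v) = (\<integral>\<^sup>+\<omega>. L (restrict \<omega> {0..<Suc (Suc m)}) \<partial>srw G v)"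
    by (intro nn_integral_cong) (simp add: L_def Int_absorb1 ivl_subset)
  also have "\<dots> = (\<integral>\<^sup>+\<omega>. L \<omega> \<partial>?C (Suc (Suc m)))"
    by (rule prefix[OF L])
  also have "\<dots> = (\<integral>\<^sup>+\<omega>. (\<integral>\<^sup>+\<omega>'. L \<omega>' \<partial>eP (Suc m) \<omega>) \<partial>?C (Suc m))"
  proof -
    have eP: "eP (Suc m) \<in> measurable (?C (Suc m)) (subprob_algebra (?M (Suc (Suc m))))"
      using measurable_eP[of "Suc m"] by (simp only: measurable_cong_sets[OF st refl])
    show ?thesis
      unfolding C.simps(2)[of 0 "Suc m"] add_0 by (rule nn_integral_bind[OF L eP])
  qed
  also have "\<dots> = (\<integral>\<^sup>+\<omega>. F \<omega> * K (\<omega> m) \<partial>?C (Suc m))"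
  proof (rule nn_integral_cong)
    fix \<omega> assume "\<omega> \<in> space (?C (Suc m))"
    then have \<omega>: "\<omega> \<in> space (?M (Suc m))"
      by (simp only: sp)
    \<comment> \<open>\<open>eP\<close> only appends the coordinate \<open>Suc m\<close>, so the
      factor \<open>F\<close> is constant under the inner integral and can be pulled out.\<close>
    have "restrict (fun_upd \<omega> (Suc m) y) {0..<Suc m} = \<omega>" for y
      using \<omega> by (auto simp: space_PiM PiE_iff extensional_def fun_eq_iff)
    then have "L (fun_upd \<omega> (Suc m) y) = F \<omega> * g y" for y
      by (simp add: L_def)
    then show "(\<integral>\<^sup>+\<omega>'. L \<omega>' \<partial>eP (Suc m) \<omega>) = F \<omega> * K (\<omega> m)"
      by (simp add: nn_integral_eP[OF \<omega> L] srw_kernel_def K_def nn_integral_cmult)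
  qed
  also have "\<dots> = (\<integral>\<^sup>+\<omega>. F (restrict \<omega> {0..<Suc m}) * K (restrict \<omega> {0..<Suc m} m) \<partial>srw G v)"
    by (rule prefix[OF FK, symmetric])
  finally show ?thesis
    by (simp add: L_def K_def)
qed

lemma AE_srw_start: "AE \<omega> in srw G v. \<omega> 0 = v"
proof -
  interpret prob_space "srw G v" by (rule prob_space_srw)
  have "emeasure (srw G v) {\<omega>. \<omega> 0 = v} = 1"
    using emeasure_srw_cylinder[of G v 0 "\<lambda>_. v"] by simp
  then show ?thesis
    by (subst AE_iff_emeasure_eq_1) auto
qed

section \<open>Hitting times and the Poisson equation\<close>

text \<open>Tail-sum formula: each time \<open>m\<close> before the first visit contributes one. It
  turns the expected hitting time into a sum of survival probabilities, and also covers trajectories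
  that never visit \<open>u\<close>.\<close>

lemma ennreal_of_enat_hitting_time:
  "ennreal_of_enat (hitting_time u \<omega>) = (\<Sum>m. indicator {\<omega>. \<forall>j\<le>m. \<omega> j \<noteq> u} \<omega>)"
proof (cases "\<exists>m. \<omega> m = u")
  case False
  have "(\<Sum>m. 1 :: ennreal) = (SUP n::nat. \<Sum>m<n. 1)"
    by (rule suminf_eq_SUP)
  also have "\<dots> = \<top>"
    by (simp add: ennreal_SUP_of_nat_eq_top)
  finally have "(\<Sum>m. 1 :: ennreal) = \<top>" .
  with False show ?thesis
    by (simp add: hitting_time_def top_enat_def)
next
  case True
  define l where "l = (LEAST m. \<omega> m = u)"
  have l: "\<omega> l = u" "\<And>m. \<omega> m = u \<Longrightarrow> l \<le> m"
    using True by (auto simp: l_def intro: LeastI_ex Least_le)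
  have "hitting_time u \<omega> = enat l"
    unfolding hitting_time_def by (rule antisym) (auto intro!: INF_lower INF_greatest l)
  moreover have "(indicator {\<omega>. \<forall>j\<le>m. \<omega> j \<noteq> u} \<omega> :: ennreal) = (if m < l then 1 else 0)" for m
  proof (cases "m < l")
    case True
    then have "\<omega> j \<noteq> u" if "j \<le> m" for j
      using l(2)[of j] that by linarith
    with True show ?thesis by simp
  next
    case False
    with l(1) show ?thesis by (auto simp: not_less indicator_def)
  qed
  moreover have "(\<Sum>m. if m < l then 1 else 0 :: ennreal) = (\<Sum>m<l. if m < l then 1 else 0)"
    by (rule suminf_finite) auto
  ultimately show ?thesis by simp
qed

text \<open>Along the walk stopped at \<open>u\<close>, the sum of \<open>h\<close> and the elapsed time is a martingale;
  as \<open>h\<close> is bounded, finiteness of the expected hitting time makes the boundary term vanish.\<close>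
lemma expected_hitting_time_eqI:
  fixes h :: "'a \<Rightarrow> ennreal"
  assumes v: "v \<in> V" and hu: "h u = 0"
    and bound: "\<And>x. x \<in> V \<Longrightarrow> h x \<le> b" and b: "b < \<infinity>"
    and closed: "\<And>x. x \<in> V \<Longrightarrow> x \<noteq> u \<Longrightarrow> set_pmf (srw_step G x) \<subseteq> V"
    and step: "\<And>x. x \<in> V \<Longrightarrow> x \<noteq> u \<Longrightarrow> h x = 1 + (\<integral>\<^sup>+y. h y \<partial>srw_step G x)"
  shows "expected_hitting_time G v u = h v"
proof -
  interpret prob_space "srw G v" by (rule prob_space_srw)
  define A where "A m = {\<omega>. \<forall>j\<le>m. \<omega> j \<noteq> u}" for m :: nat
  have ind: "indicator (A m) \<omega> = (indicator (A m) (restrict \<omega> {0..<Suc m}) :: ennreal)" for m \<omega>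
    by (auto simp: A_def indicator_def)
  have A_meas [measurable]: "A m \<in> sets (srw G v)" for m
  proof -
    have "{\<omega> \<in> space (srw G v). \<forall>j\<le>m. \<omega> j \<noteq> u} \<in> sets (srw G v)"
      by measurable
    then show ?thesis by (simp add: A_def)
  qed
  have F: "indicator (A m) \<in> borel_measurable (PiM {0..<Suc m} (\<lambda>_. count_space UNIV))" for m
  proof -
    let ?M = "PiM {0..<Suc m} (\<lambda>_. count_space (UNIV :: 'a set))"
    have [measurable]: "(\<lambda>\<omega>. \<omega> j) \<in> measurable ?M (count_space UNIV)"
      if "j \<in> {..m}" for j
      using that by (intro measurable_component_singleton) auto
    have "{\<omega> \<in> space ?M. \<forall>j\<in>{..m}. \<omega> j \<noteq> u} \<in> sets ?M"
      by measurable
    then have "indicator {\<omega> \<in> space ?M. \<forall>j\<in>{..m}. \<omega> j \<noteq> u} \<in> borel_measurable ?M"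
      by (rule borel_measurable_indicator)
    then show ?thesis
      by (rule measurable_cong[THEN iffD1, rotated]) (auto simp: A_def indicator_def)
  qed
  have markov: "(\<integral>\<^sup>+\<omega>. indicator (A m) \<omega> * g (\<omega> (Suc m)) \<partial>srw G v) =
      (\<integral>\<^sup>+\<omega>. indicator (A m) \<omega> * (\<integral>\<^sup>+y. g y \<partial>srw_step G (\<omega> m)) \<partial>srw G v)"
    for m :: nat and g :: "'a \<Rightarrow> ennreal"
    using markov_srw[OF F[of m], of G v g] by (simp add: ind[symmetric])
  have meas: "(\<lambda>\<omega>. g (\<omega> m)) \<in> borel_measurable (srw G v)" for m :: nat and g :: "'a \<Rightarrow> ennreal"
    by (rule measurable_compose[OF measurable_srw_component]) simp
  \<comment> \<open>The hypotheses on \<open>h\<close> hold only inside \<open>V\<close>, so the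
    surviving walk must almost surely stay there. The induction step applies \<open>markov\<close>
    to the indicator of the complement of \<open>V\<close>.\<close>
  have AE_V: "AE \<omega> in srw G v. \<omega> \<in> A m \<longrightarrow> \<omega> m \<in> V" for m
  proof (induction m)
    case 0
    show ?case
      using AE_srw_start[of v G] by eventually_elim (use v in auto)
  next
    case (Suc m)
    have "(\<integral>\<^sup>+\<omega>. indicator (A m) \<omega> * indicator (- V) (\<omega> (Suc m)) \<partial>srw G v) =
        (\<integral>\<^sup>+\<omega>. indicator (A m) \<omega> * (\<integral>\<^sup>+y. indicator (- V) y \<partial>srw_step G (\<omega> m)) \<partial>srw G v)"
      by (rule markov)
    also have "\<dots> = (\<integral>\<^sup>+\<omega>. 0 \<partial>srw G v)"
    proof (intro nn_integral_cong_AE)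
      show "AE \<omega> in srw G v. indicator (A m) \<omega> * (\<integral>\<^sup>+y. indicator (- V) y \<partial>srw_step G (\<omega> m)) = 0"
        using Suc.IH
      proof eventually_elim
        case (elim \<omega>)
        show ?case
        proof (cases "\<omega> \<in> A m")
          case True
          with elim have "\<omega> m \<in> V" "\<omega> m \<noteq> u" by (auto simp: A_def)
          from closed[OF this] have "AE y in srw_step G (\<omega> m). indicator (- V) y = (0 :: ennreal)"
            by (auto simp: AE_measure_pmf_iff)
          then have "(\<integral>\<^sup>+y. indicator (- V) y \<partial>srw_step G (\<omega> m)) = (\<integral>\<^sup>+y. 0 \<partial>srw_step G (\<omega> m))"
            by (rule nn_integral_cong_AE)
          then show ?thesis by simp
        qed simp
      qed
    qed
    finally have "(\<integral>\<^sup>+\<omega>. indicator (A m) \<omega> * indicator (- V) (\<omega> (Suc m)) \<partial>srw G v) = 0"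
      by simp
    then have "AE \<omega> in srw G v. indicator (A m) \<omega> * indicator (- V) (\<omega> (Suc m)) = (0 :: ennreal)"
      by (rule nn_integral_0_iff_AE[THEN iffD1, rotated])
        (auto intro!: borel_measurable_times_ennreal meas)
    then show ?case
    proof eventually_elim
      case (elim \<omega>)
      have "\<omega> \<in> A m" if "\<omega> \<in> A (Suc m)"
        using that by (auto simp: A_def)
      with elim show ?case
        by (auto simp: indicator_def split: if_splits)
    qed
  qed
  define W where "W m = (\<integral>\<^sup>+\<omega>. indicator (A m) \<omega> * h (\<omega> m) \<partial>srw G v)" for m
  define p where "p m = emeasure (srw G v) (A m)" for m
  have W0: "W 0 = h v"
  proof -
    have "W 0 = (\<integral>\<^sup>+\<omega>. h v \<partial>srw G v)"
      unfolding W_def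
    proof (rule nn_integral_cong_AE)
      show "AE \<omega> in srw G v. indicator (A 0) \<omega> * h (\<omega> 0) = h v"
        using AE_srw_start[of v G] by eventually_elim (auto simp: A_def indicator_def hu)
    qed
    then show ?thesis by (simp add: emeasure_space_1[simplified])
  qed
  have WS: "W m = p m + W (Suc m)" for m
  proof -
    have "W m = (\<integral>\<^sup>+\<omega>. indicator (A m) \<omega> + indicator (A m) \<omega> * (\<integral>\<^sup>+y. h y \<partial>srw_step G (\<omega> m)) \<partial>srw G v)"
      unfolding W_def
    proof (rule nn_integral_cong_AE)
      show "AE \<omega> in srw G v. indicator (A m) \<omega> * h (\<omega> m) =
          indicator (A m) \<omega> + indicator (A m) \<omega> * (\<integral>\<^sup>+y. h y \<partial>srw_step G (\<omega> m))"
        using AE_V[of m]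
      proof eventually_elim
        case (elim \<omega>)
        then show ?case
          using step[of "\<omega> m"] by (cases "\<omega> \<in> A m") (auto simp: A_def)
      qed
    qed
    also have "\<dots> = p m + (\<integral>\<^sup>+\<omega>. indicator (A m) \<omega> * (\<integral>\<^sup>+y. h y \<partial>srw_step G (\<omega> m)) \<partial>srw G v)"
      by (subst nn_integral_add) (auto simp: p_def intro!: borel_measurable_times_ennreal meas)
    also have "\<dots> = p m + (\<integral>\<^sup>+\<omega>. indicator (A m) \<omega> * h (\<omega> (Suc m)) \<partial>srw G v)"
      by (simp add: markov)
    \<comment> \<open>The two events differ only when the walk is at \<open>u\<close> at time
      \<open>Suc m\<close>, where \<open>h\<close> vanishes.\<close>
    also have "(\<lambda>\<omega>. indicator (A m) \<omega> * h (\<omega> (Suc m))) = (\<lambda>\<omega>. indicator (A (Suc m)) \<omega> * h (\<omega> (Suc m)))"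
    proof (rule ext)
      show "indicator (A m) \<omega> * h (\<omega> (Suc m)) = indicator (A (Suc m)) \<omega> * h (\<omega> (Suc m))" for \<omega>
        by (cases "\<omega> (Suc m) = u") (auto simp: A_def indicator_def hu le_Suc_eq)
    qed
    finally show ?thesis by (simp add: W_def)
  qed
  \<comment> \<open>Telescoping: expected time elapsed plus expected remaining potential is
    conserved. It remains to show that \<open>W\<close> tends to 0. The partial sums of
    \<open>p\<close> are at most \<open>h v\<close>, which is finite, so \<open>p\<close> tends to
    0, and \<open>W m\<close> is at most \<open>b * p m\<close>.\<close>
  have sum: "(\<Sum>j<m. p j) + W m = h v" for m
    by (induction m) (simp_all add: W0 add.assoc WS[symmetric])
  have fin: "h v < \<infinity>"
    using bound[OF v] b by (rule le_less_trans)
  have sum_le: "(\<Sum>j. p j) \<le> h v"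
  proof (rule suminf_le_const)
    show "(\<Sum>j<m. p j) \<le> h v" for m
      unfolding sum[of m, symmetric] by simp
  qed simp
  have p_eq: "p = (\<lambda>j. ennreal (prob (A j)))"
    by (auto simp: p_def emeasure_eq_measure)
  have "(\<Sum>j. ennreal (prob (A j))) \<noteq> \<top>"
    using le_less_trans[OF sum_le fin] by (simp add: p_eq)
  then have "summable (\<lambda>j. prob (A j))"
    by (rule summable_suminf_not_top[rotated]) simp
  then have p0: "p \<longlonglongrightarrow> 0"
    unfolding p_eq ennreal_0[symmetric] by (intro tendsto_ennrealI summable_LIMSEQ_zero)
  have Wb: "W m \<le> b * p m" for m
  proof -
    have "W m \<le> (\<integral>\<^sup>+\<omega>. b * indicator (A m) \<omega> \<partial>srw G v)"
      unfolding W_def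
    proof (rule nn_integral_mono_AE)
      show "AE \<omega> in srw G v. indicator (A m) \<omega> * h (\<omega> m) \<le> b * indicator (A m) \<omega>"
        using AE_V[of m] by eventually_elim (auto simp: indicator_def bound)
    qed
    then show ?thesis by (simp add: p_def nn_integral_cmult_indicator)
  qed
  have "(\<lambda>m. b * p m) \<longlonglongrightarrow> b * 0"
    by (rule ennreal_tendsto_cmult[OF _ p0]) (use b in simp)
  then have "(\<lambda>m. b * p m) \<longlonglongrightarrow> 0" by simp
  then have "W \<longlonglongrightarrow> 0"
    by (rule tendsto_sandwich[rotated 2, OF tendsto_const]) (auto simp: Wb)
  then have "(\<lambda>m. (\<Sum>j<m. p j) + W m) \<longlonglongrightarrow> (\<Sum>j. p j) + 0"
    by (intro tendsto_add summable_LIMSEQ) auto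
  then have "(\<Sum>j. p j) = h v"
    by (simp add: sum LIMSEQ_const_iff)
  moreover have "expected_hitting_time G v u = (\<Sum>m. p m)"
    unfolding expected_hitting_time_def ennreal_of_enat_hitting_time A_def[symmetric] p_def
    by (subst nn_integral_suminf) auto
  ultimately show ?thesis by simp
qed

lemma nn_integral_srw_step:
  assumes "finite {y. (x, y) \<in> parcs G}" "{y. (x, y) \<in> parcs G} \<noteq> {}"
  shows "(\<integral>\<^sup>+y. f y \<partial>srw_step G x) =
    (\<Sum>y | (x, y) \<in> parcs G. f y) / card {y. (x, y) \<in> parcs G}"
  unfolding srw_step_def by (rule nn_integral_pmf_of_set) (use assms in auto)

text \<open>The Poisson equation cleared of its division by the degree and moved to the reals, where
  differences behave well. Nonnegativity keeps \<open>ennreal\<close> from truncating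
  \<open>h\<close>.\<close>

lemma (in pair_graph) expected_hitting_time_eq_potential:
  fixes h :: "'a \<Rightarrow> real"
  assumes v: "v \<in> pverts G" and hu: "h u = 0"
    and nonneg: "\<And>x. x \<in> pverts G \<Longrightarrow> 0 \<le> h x"
    and nbr: "\<And>x. x \<in> pverts G \<Longrightarrow> x \<noteq> u \<Longrightarrow> {y. (x, y) \<in> parcs G} \<noteq> {}"
    and step: "\<And>x. x \<in> pverts G \<Longrightarrow> x \<noteq> u \<Longrightarrow>
      (\<Sum>y | (x, y) \<in> parcs G. h x - h y) = card {y. (x, y) \<in> parcs G}"
  shows "expected_hitting_time G v u = ennreal (h v)"
proof -
  have sub: "{y. (x, y) \<in> parcs G} \<subseteq> pverts G" for x
    by (auto dest: arc_snd_in_verts)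
  have fin: "finite {y. (x, y) \<in> parcs G}" for x
    by (rule finite_subset[OF sub pair_finite_verts])
  show ?thesis
  proof (rule expected_hitting_time_eqI[where V = "pverts G" and h = "\<lambda>x. ennreal (h x)"
        and b = "ennreal (\<Sum>x\<in>pverts G. h x)"])
    \<comment> \<open>As the graph is finite and \<open>h\<close> nonnegative, the total of
      \<open>h\<close> serves as a crude uniform bound.\<close>
    show "ennreal (h x) \<le> ennreal (\<Sum>x\<in>pverts G. h x)" if "x \<in> pverts G" for x
      using that by (intro ennreal_leI member_le_sum) (auto simp: nonneg)
    fix x assume x: "x \<in> pverts G" "x \<noteq> u"
    let ?N = "{y. (x, y) \<in> parcs G}"
    show "set_pmf (srw_step G x) \<subseteq> pverts G"
      unfolding srw_step_def using set_pmf_of_set[OF nbr[OF x] fin] sub by simp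
    have card: "real (card ?N) > 0"
      using nbr[OF x] fin by (simp add: card_gt_0_iff)
    have s0: "(\<Sum>y\<in>?N. h y) \<ge> 0"
      using sub by (intro sum_nonneg nonneg) auto
    have "h x = 1 + (\<Sum>y\<in>?N. h y) / card ?N"
      using step[OF x] card by (simp add: sum_subtractf field_simps)
    also have "ennreal \<dots> = 1 + ennreal (\<Sum>y\<in>?N. h y) / ennreal (card ?N)"
      using card s0 by (simp add: divide_ennreal)
    also have "ennreal (\<Sum>y\<in>?N. h y) = (\<Sum>y\<in>?N. ennreal (h y))"
      using sub by (intro sum_ennreal[symmetric] nonneg) auto
    finally show "ennreal (h x) = 1 + (\<integral>\<^sup>+y. ennreal (h y) \<partial>srw_step G x)"
      by (simp add: nn_integral_srw_step[OF fin nbr[OF x]] ennreal_of_nat_eq_real_of_nat)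
  qed (use v hu in auto)
qed

section \<open>Neighbourhoods and the explicit potential on the tree\<close>

lemma nbrs_Spine:
  "{y. (Spine i, y) \<in> parcs (spine_tree n k cs)} =
    (if 1 \<le> i \<and> i < n then {Spine (Suc i)} else {}) \<union>
    (if 2 \<le> i \<and> i \<le> n then {Spine (i - 1)} else {}) \<union>
    (if i = k then (\<lambda>l. Pendant l 1) ` {..<length cs} else {})"
  by (auto simp: spine_tree_def Let_def)

lemma nbrs_Pendant:
  assumes "l < length cs" "1 \<le> j" "j \<le> cs ! l"
  shows "{y. (Pendant l j, y) \<in> parcs (spine_tree n k cs)} =
    (if j < cs ! l then {Pendant l (Suc j)} else {}) \<union>
    {if j = 1 then Spine k else Pendant l (j - 1)}"
  using assms by (auto simp: spine_tree_def Let_def)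

text \<open>The two branches agree at \<open>i = k\<close>, and the value at \<open>i = n\<close> is
  0 when \<open>k \<le> n\<close>. Subtraction is in the reals, so \<open>d = 0\<close> causes no
  truncation.\<close>

definition spine_time :: "nat \<Rightarrow> nat \<Rightarrow> nat \<Rightarrow> nat \<Rightarrow> real" where
  "spine_time n k d i =
    (if i < k then (real n)\<^sup>2 - (real k)\<^sup>2 + 2 * (real d - 1) * (real n - real k)
        + (real k - 1)\<^sup>2 - (real i - 1)\<^sup>2
     else (real n)\<^sup>2 - (real i)\<^sup>2 + 2 * (real d - 1) * (real n - real i))"

text \<open>On a pendant path with \<open>c\<close> vertices the time to get from its \<open>j\<close>-th vertex one step closer
  to the spine is \<open>2 * (c - j) + 1\<close>; these times sum to \<open>2 * c * j - j\<^sup>2\<close>.\<close>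
fun tree_time :: "nat \<Rightarrow> nat \<Rightarrow> nat list \<Rightarrow> vertex \<Rightarrow> real" where
  "tree_time n k cs (Spine i) = spine_time n k (sum_list cs) i"
| "tree_time n k cs (Pendant l j) =
    spine_time n k (sum_list cs) k + 2 * real (cs ! l) * real j - (real j)\<^sup>2"

text \<open>This is the edge difference 2m - 1, with m the number of vertices behind the edge; the
  pendant vertices add \<open>2 * d\<close> from \<open>k\<close> onwards.\<close>

lemma spine_time_Suc:
  "spine_time n k d i - spine_time n k d (Suc i) =
    (if i < k then 2 * real i - 1 else 2 * real i - 1 + 2 * real d)"
proof (cases "Suc i = k")
  case True
  then show ?thesis
    by (auto simp: spine_time_def power2_eq_square algebra_simps)
qed (auto simp: spine_time_def power2_eq_square algebra_simps)

text \<open>Downward induction from \<open>n\<close>, where the value is 0: all differences are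
  positive for \<open>i \<ge> 1\<close>.\<close>

lemma spine_time_nonneg:
  assumes "1 \<le> i" "i \<le> n" "1 \<le> k" "k \<le> n"
  shows "0 \<le> spine_time n k d i"
  using assms(2,1)
proof (induction rule: inc_induct)
  case base
  then show ?case using assms by (simp add: spine_time_def)
next
  case (step m)
  then show ?case using spine_time_Suc[of n k d m] by (auto split: if_splits)
qed

section \<open>Verification of the degree identity at every vertex\<close>

theorem theorem7:
  fixes n k d :: nat and cs :: "nat list"
  assumes "3 \<le> n" and "2 \<le> k" and "k \<le> n - 1"
    and "\<forall>c\<in>set cs. 1 \<le> c"
    and "d = sum_list cs"
  shows "(\<forall>i\<in>{1..k - 1}.
            expected_hitting_time (spine_tree n k cs) (Spine i) (Spine n) =
              ennreal ((real n)\<^sup>2 - (real k)\<^sup>2 + 2 * (real d - 1) * (real n - real k)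
                       + (real k - 1)\<^sup>2 - (real i - 1)\<^sup>2)) \<and>
         (\<forall>i\<in>{k..n - 1}.
            expected_hitting_time (spine_tree n k cs) (Spine i) (Spine n) =
              ennreal ((real n)\<^sup>2 - (real i)\<^sup>2 + 2 * (real d - 1) * (real n - real i)))"
proof -
  let ?G = "spine_tree n k cs" and ?h = "tree_time n k cs"
  interpret pair_graph ?G
    by (rule pair_graph_spine_tree) (use assms in auto)
  have sum_h: "(\<Sum>y | (x, y) \<in> parcs ?G. ?h x - ?h y) = card {y. (x, y) \<in> parcs ?G}"
    and nbr: "{y. (x, y) \<in> parcs ?G} \<noteq> {}"
    if x: "x \<in> pverts ?G" "x \<noteq> Spine n" for x
  proof -
    show "{y. (x, y) \<in> parcs ?G} \<noteq> {}"
    proof (cases x)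
      case (Spine i)
      then have "1 \<le> i" "i < n"
        using x by (auto simp: spine_tree_def Let_def)
      then show ?thesis
        unfolding Spine nbrs_Spine by simp
    next
      case (Pendant l j)
      then have "l < length cs" "1 \<le> j" "j \<le> cs ! l"
        using x by (auto simp: spine_tree_def Let_def)
      then show ?thesis
        unfolding Pendant by (subst nbrs_Pendant) auto
    qed
    show "(\<Sum>y | (x, y) \<in> parcs ?G. ?h x - ?h y) = card {y. (x, y) \<in> parcs ?G}"
    proof (cases x)
      case (Pendant l j)
      then have lj: "l < length cs" "1 \<le> j" "j \<le> cs ! l"
        using x by (auto simp: spine_tree_def Let_def)
      then obtain i where j: "j = Suc i" by (cases j) auto
      show ?thesis
        \<comment> \<open>For \<open>i = 0\<close> the inner neighbour is \<open>Spine k\<close>,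
          whose value is the pendant formula at position 0, so both cases are the same
          computation.\<close>
        unfolding Pendant nbrs_Pendant[OF lj] using lj unfolding j
        by (cases i) (auto simp: power2_eq_square algebra_simps)
    next
      case (Spine i)
      then have i: "1 \<le> i" "i < n"
        using x by (auto simp: spine_tree_def Let_def)
      define j where "j = i - 1"
      have ij: "i = Suc j" using i by (simp add: j_def)
      note up = spine_time_Suc[of n k "sum_list cs" i]
        and down = spine_time_Suc[of n k "sum_list cs" j, folded ij]
      show ?thesis
      proof (cases "i = k")
        case True
        let ?P = "(\<lambda>l. Pendant l 1) ` {..<length cs}"
        have N: "{y. (x, y) \<in> parcs ?G} = insert (Spine (Suc i)) (insert (Spine j) ?P)"
          unfolding Spine nbrs_Spine using i True assms(2) by (auto simp: j_def)
        have inj: "inj_on (\<lambda>l. Pendant l 1) {..<length cs}"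
          by (auto simp: inj_on_def)
        \<comment> \<open>At the branching vertex the pendant edges contribute the number of paths
          minus \<open>2 * d\<close>; the \<open>2 * d\<close> cancels against \<open>up\<close>,
          and the two spine edges leave 2.\<close>
        have "(\<Sum>y\<in>?P. ?h x - ?h y) = (\<Sum>l<length cs. 1 - 2 * real (cs ! l))"
          by (subst sum.reindex[OF inj]) (simp add: Spine True)
        also have "\<dots> = real (length cs) - 2 * real (sum_list cs)"
          by (simp add: sum_subtractf sum_list_sum_nth sum_distrib_left atLeast0LessThan)
        finally have P: "(\<Sum>y\<in>?P. ?h x - ?h y) = real (length cs) - 2 * real (sum_list cs)" .
        have "card ?P = length cs" using card_image[OF inj] by simp
        moreover have "Spine (Suc i) \<notin> insert (Spine j) ?P" "Spine j \<notin> ?P"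
          by (auto simp: j_def)
        ultimately show ?thesis
          unfolding N using up down True ij P by (simp add: Spine)
      next
        case False
        show ?thesis
        \<comment> \<open>The end \<open>Spine 1\<close> has degree 1 and difference 1. At any other
          \<open>i\<close> different from \<open>k\<close>, both spine edges lie on the same side of
          \<open>k\<close>, so their differences \<open>up\<close> and \<open>down\<close> differ by
          exactly 2.\<close>
        proof (cases "i = 1")
          case True
          then show ?thesis
            unfolding Spine nbrs_Spine using i False up assms(2) by simp
        next
          case one: False
          have "{y. (x, y) \<in> parcs ?G} = {Spine (Suc i), Spine j}"
            unfolding Spine nbrs_Spine using i False one by (auto simp: j_def)
          moreover have "Suc i \<noteq> j" by (simp add: j_def)
          ultimately show ?thesis
            using up down False ij by (auto simp: Spine split: if_splits)
        qed
      qed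
    qed
  qed
  have nonneg: "0 \<le> ?h x" if "x \<in> pverts ?G" for x
  proof (cases x)
    case (Spine i)
    then show ?thesis
      using that assms by (auto simp: spine_tree_def Let_def intro!: spine_time_nonneg)
  next
    case (Pendant l j)
    then have j: "j \<le> cs ! l"
      using that by (auto simp: spine_tree_def Let_def)
    have "0 \<le> spine_time n k (sum_list cs) k"
      using assms by (intro spine_time_nonneg) auto
    moreover have "(real j)\<^sup>2 \<le> 2 * real (cs ! l) * real j"
      unfolding power2_eq_square using j by (intro mult_right_mono) auto
    ultimately show ?thesis by (simp add: Pendant)
  qed
  have "expected_hitting_time ?G (Spine i) (Spine n) = ennreal (spine_time n k d i)"
    if "1 \<le> i" "i \<le> n" for i
  proof -
    have "expected_hitting_time ?G (Spine i) (Spine n) = ennreal (?h (Spine i))"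
    proof (rule expected_hitting_time_eq_potential)
      show "Spine i \<in> pverts ?G"
        using that by (simp add: spine_tree_def Let_def)
      show "?h (Spine n) = 0"
        using assms(1-3) by (auto simp: spine_time_def)
    qed (fact nonneg nbr sum_h)+
    then show ?thesis by (simp add: assms(5))
  qed
  then show ?thesis
    using assms(1-3) by (auto simp: spine_time_def)
qed

end
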